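(* Let $\mathcal{H}$ be a separable Hilbert space, $U\in\mathcal{B}(\mathcal{H})$, and let $\Phi=\{\phi_i\}_{i\in I}$ and $\Psi=\{\psi_i\}_{i\in I}$ be Bessel sequences in $\mathcal{H}$ with Bessel bounds $B_\Phi$ and $B_\Psi$ such that $\mathbf{G}_{U,\Phi,\Psi}$ is invertible on $\ell^2(I)$. (1) If $V\in\mathcal{B}(\mathcal{H})$ is such that $\|U-V\|<\dfrac{1}{\|\mathbf{G}_{U,\Phi,\Psi}^{-1}\|\sqrt{B_\Phi B_\Psi}}$, then $\mathbf{G}_{V,\Phi,\Psi}$ is also invertible. (2) If $\Xi=\{\xi_i\}_{i\in I}$ is a Bessel sequence in $\mathcal{H}$ such that $\left(\sum_{i\in I}\|\psi_i-\xi_i\|^2\right)^{1/2}<\dfrac{1}{\|\mathbf{G}_{U,\Phi,\Psi}^{-1}\|\sqrt{B_\Phi}\,\|U\|}$, then $\mathbf{G}_{U,\Phi,\Xi}$ is invertible. (3) If $\Theta=\{\theta_i\}_{i\in I}$ is a Bessel sequence in $\mathcal{H}$ such that $\left(\sum_{i\in I}\|\phi_i-\theta_i\|^2\right)^{1/2}<\dfrac{1}{\|\mathbf{G}_{U,\Phi,\Psi}^{-1}\|\sqrt{B_\Psi}\,\|U\|}$, then $\mathbf{G}_{U,\Theta,\Psi}$ is invertible.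
   Context: All Hilbert spaces are separable, $I$ is a countable index set, $\ell^2=\ell^2(I)$, $\mathcal{B}(\mathcal{H})$ is the set of bounded linear operators on $\mathcal{H}$. A sequence $\Phi=\{\phi_i\}_{i\in I}$ in $\mathcal{H}$ is a Bessel sequence with Bessel bound $B_\Phi>0$ if $\sum_{i}|\langle f,\phi_i\rangle|^2\le B_\Phi\|f\|^2$ for all $f\in\mathcal{H}$; its synthesis operator is $T_\Phi:\ell^2\to\mathcal{H}$, $T_\Phi\{c_i\}=\sum_ic_i\phi_i$. For Bessel sequences $\Phi,\Psi$ in $\mathcal{H}$ and $U\in\mathcal{B}(\mathcal{H})$, the $U$-cross Gram matrix is $(\mathbf{G}_{U,\Phi,\Psi})_{i,j}=\langle U\psi_j,\phi_i\rangle$, equivalently the bounded operator $T_\Phi^*UT_\Psi$ on $\ell^2$. Invertibility means invertibility as a bounded operator on $\ell^2$. *)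

theory Defs
  imports "HOL-Analysis.Analysis"
begin

(* The inner product is linear in the first and conjugate-linear in the second argument. *)
class complex_inner = real_normed_vector +
  fixes scaleC :: "complex \<Rightarrow> 'a \<Rightarrow> 'a"  (infixr "*\<^sub>C" 75)
    and cinner :: "'a \<Rightarrow> 'a \<Rightarrow> complex"
  assumes scaleC_add_right: "a *\<^sub>C (x + y) = a *\<^sub>C x + a *\<^sub>C y"
    and scaleC_add_left: "(a + b) *\<^sub>C x = a *\<^sub>C x + b *\<^sub>C x"
    and scaleC_scaleC: "a *\<^sub>C (b *\<^sub>C x) = (a * b) *\<^sub>C x"
    and scaleR_scaleC: "r *\<^sub>R x = complex_of_real r *\<^sub>C x"
    and cinner_add_left: "cinner (x + y) z = cinner x z + cinner y z"
    and cinner_scaleC_left: "cinner (a *\<^sub>C x) y = a * cinner x y"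
    and cinner_commute: "cinner x y = cnj (cinner y x)"
    and cinner_self: "cinner x x = complex_of_real ((norm x)\<^sup>2)"

class chilbert_space = complex_inner + complete_space

subclass (in chilbert_space) banach ..

definition bounded_clinear :: "('a::complex_inner \<Rightarrow> 'b::complex_inner) \<Rightarrow> bool" where
  "bounded_clinear T \<longleftrightarrow> bounded_linear T \<and> (\<forall>a x. T (a *\<^sub>C x) = a *\<^sub>C T x)"

(* For such T the bounded inverse is the function inv T. *)
definition bounded_invertible :: "('a::complex_inner \<Rightarrow> 'b::complex_inner) \<Rightarrow> bool" where
  "bounded_invertible T \<longleftrightarrow>
     bounded_clinear T \<and> (\<exists>S. bounded_clinear S \<and> S \<circ> T = id \<and> T \<circ> S = id)"

definition sq_summable :: "('i \<Rightarrow> complex) \<Rightarrow> bool" where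
  "sq_summable x \<longleftrightarrow> (\<lambda>i. (cmod (x i))\<^sup>2) summable_on UNIV"

definition l2_norm :: "('i \<Rightarrow> complex) \<Rightarrow> real" where
  "l2_norm x = sqrt (\<Sum>\<^sub>\<infinity>i. (cmod (x i))\<^sup>2)"

lemma l2_norm_nonneg: "0 \<le> l2_norm x"
  by (simp add: l2_norm_def infsum_nonneg)

lemma l2_norm_sq: "(l2_norm x)\<^sup>2 = (\<Sum>\<^sub>\<infinity>i. (cmod (x i))\<^sup>2)"
  by (simp add: l2_norm_def infsum_nonneg)

lemma L2_set_le_l2_norm:
  assumes "sq_summable x" "finite F"
  shows "L2_set (\<lambda>i. cmod (x i)) F \<le> l2_norm x"
  unfolding L2_set_def l2_norm_def
  using assms by (auto intro!: finite_sum_le_infsum simp: sq_summable_def)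

lemma sq_summable_bounded:
  assumes "\<And>F. finite F \<Longrightarrow> L2_set (\<lambda>i. cmod (x i)) F \<le> B"
  shows "sq_summable x" and "l2_norm x \<le> B"
proof -
  have B0: "0 \<le> B"
    using assms[of "{}"] by simp
  have fin: "(\<Sum>i\<in>F. (cmod (x i))\<^sup>2) \<le> B\<^sup>2" if "finite F" for F
  proof -
    have "(L2_set (\<lambda>i. cmod (x i)) F)\<^sup>2 \<le> B\<^sup>2"
      using assms[OF that] by (intro power_mono) auto
    then show ?thesis
      by (simp add: L2_set_def sum_nonneg)
  qed
  show *: "sq_summable x"
    unfolding sq_summable_def
    by (rule nonneg_bdd_above_summable_on) (auto intro!: bdd_aboveI[of _ "B\<^sup>2"] fin)
  have "(\<Sum>\<^sub>\<infinity>i. (cmod (x i))\<^sup>2) \<le> B\<^sup>2"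
    using * fin by (intro infsum_le_finite_sums) (auto simp: sq_summable_def)
  then show "l2_norm x \<le> B"
    using B0 by (simp add: l2_norm_def real_le_lsqrt infsum_nonneg)
qed

lemma sq_summable_add:
  assumes "sq_summable x" "sq_summable y"
  shows "sq_summable (\<lambda>i. x i + y i)" and "l2_norm (\<lambda>i. x i + y i) \<le> l2_norm x + l2_norm y"
proof -
  have *: "L2_set (\<lambda>i. cmod (x i + y i)) F \<le> l2_norm x + l2_norm y" if "finite F" for F
  proof -
    have "L2_set (\<lambda>i. cmod (x i + y i)) F \<le> L2_set (\<lambda>i. cmod (x i) + cmod (y i)) F"
      by (rule L2_set_mono) (auto intro: norm_triangle_ineq)
    also have "\<dots> \<le> L2_set (\<lambda>i. cmod (x i)) F + L2_set (\<lambda>i. cmod (y i)) F"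
      by (rule L2_set_triangle_ineq)
    also have "\<dots> \<le> l2_norm x + l2_norm y"
      using assms that by (intro add_mono L2_set_le_l2_norm)
    finally show ?thesis .
  qed
  show "sq_summable (\<lambda>i. x i + y i)" "l2_norm (\<lambda>i. x i + y i) \<le> l2_norm x + l2_norm y"
    by (rule sq_summable_bounded, erule *)+
qed

lemma sq_summable_scale:
  assumes "sq_summable x"
  shows "sq_summable (\<lambda>i. a * x i)"
  using assms by (auto simp: sq_summable_def norm_mult power_mult_distrib intro: summable_on_cmult_right)

lemma l2_norm_scale: "l2_norm (\<lambda>i. a * x i) = cmod a * l2_norm x"
  by (simp add: l2_norm_def norm_mult power_mult_distrib infsum_cmult_right' real_sqrt_mult)

lemma sq_summable_uminus: "sq_summable x \<Longrightarrow> sq_summable (\<lambda>i. - x i)"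
  by (simp add: sq_summable_def)

lemma sq_summable_diff:
  "sq_summable x \<Longrightarrow> sq_summable y \<Longrightarrow> sq_summable (\<lambda>i. x i - y i)"
  using sq_summable_add(1)[of x "\<lambda>i. - y i"] by (simp add: sq_summable_uminus)

lemma sq_summable_prod:
  assumes "sq_summable x" "sq_summable y"
  shows "(\<lambda>i. x i * y i) summable_on UNIV"
proof (rule abs_summable_summable)
  show "(\<lambda>i. cmod (x i * y i)) summable_on UNIV"
  proof (rule summable_on_comparison_test)
    show "(\<lambda>i. (cmod (x i))\<^sup>2 + (cmod (y i))\<^sup>2) summable_on UNIV"
      using assms by (auto simp: sq_summable_def intro: summable_on_add)
    fix i
    have "0 \<le> (cmod (x i) - cmod (y i))\<^sup>2" and "0 \<le> cmod (x i) * cmod (y i)"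
      by simp_all
    then show "cmod (x i * y i) \<le> (cmod (x i))\<^sup>2 + (cmod (y i))\<^sup>2"
      unfolding norm_mult power2_diff by linarith
    show "0 \<le> cmod (x i * y i)"
      by simp
  qed
qed

typedef 'i ell2 = "{x :: 'i \<Rightarrow> complex. sq_summable x}"
  by (rule exI[of _ "\<lambda>_. 0"]) (simp add: sq_summable_def)

setup_lifting type_definition_ell2

lemma sq_summable_Rep: "sq_summable (Rep_ell2 x)"
  using Rep_ell2 by auto

instantiation ell2 :: (type) real_vector
begin

lift_definition zero_ell2 :: "'a ell2" is "\<lambda>_. 0" by (simp add: sq_summable_def)
lift_definition plus_ell2 :: "'a ell2 \<Rightarrow> 'a ell2 \<Rightarrow> 'a ell2" is "\<lambda>x y i. x i + y i"
  by (rule sq_summable_add)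
lift_definition uminus_ell2 :: "'a ell2 \<Rightarrow> 'a ell2" is "\<lambda>x i. - x i"
  by (rule sq_summable_uminus)
lift_definition minus_ell2 :: "'a ell2 \<Rightarrow> 'a ell2 \<Rightarrow> 'a ell2" is "\<lambda>x y i. x i - y i"
  by (rule sq_summable_diff)
lift_definition scaleR_ell2 :: "real \<Rightarrow> 'a ell2 \<Rightarrow> 'a ell2" is "\<lambda>r x i. complex_of_real r * x i"
  by (rule sq_summable_scale)
instance
  by (standard; transfer; simp add: algebra_simps)

end

instantiation ell2 :: (type) real_normed_vector
begin

lift_definition norm_ell2 :: "'a ell2 \<Rightarrow> real" is l2_norm .
definition sgn_ell2 :: "'a ell2 \<Rightarrow> 'a ell2" where "sgn_ell2 x = inverse (norm x) *\<^sub>R x"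
definition dist_ell2 :: "'a ell2 \<Rightarrow> 'a ell2 \<Rightarrow> real" where "dist_ell2 x y = norm (x - y)"
definition uniformity_ell2 :: "('a ell2 \<times> 'a ell2) filter" where
  "uniformity_ell2 = (INF e\<in>{0<..}. principal {(x, y). dist x y < e})"
definition open_ell2 :: "'a ell2 set \<Rightarrow> bool" where
  "open_ell2 U \<longleftrightarrow> (\<forall>x\<in>U. \<forall>\<^sub>F (x', y) in uniformity. x' = x \<longrightarrow> y \<in> U)"

instance
proof
  fix x y :: "'a ell2" and r :: real and U :: "'a ell2 set"
  show "sgn x = x /\<^sub>R norm x" "dist x y = norm (x - y)"
    "uniformity = (INF e\<in>{0<..}. principal {(x :: 'a ell2, y). dist x y < e})"
    "open U \<longleftrightarrow> (\<forall>x\<in>U. \<forall>\<^sub>F (x', y) in uniformity. x' = x \<longrightarrow> y \<in> U)"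
    by (rule sgn_ell2_def dist_ell2_def uniformity_ell2_def open_ell2_def)+
  show "norm x = 0 \<longleftrightarrow> x = 0"
  proof (transfer, safe)
    fix x :: "'a \<Rightarrow> complex"
    assume "sq_summable x" "l2_norm x = 0"
    then have "L2_set (\<lambda>i. cmod (x i)) {i} \<le> 0" for i
      using L2_set_le_l2_norm[of x "{i}"] by simp
    then show "x = (\<lambda>_. 0)"
      by (auto simp: fun_eq_iff)
  qed (simp add: l2_norm_def)
  show "norm (x + y) \<le> norm x + norm y"
    by transfer (rule sq_summable_add)
  show "norm (r *\<^sub>R x) = \<bar>r\<bar> * norm x"
    by transfer (simp add: l2_norm_scale)
qed

end

instantiation ell2 :: (type) complex_inner
begin

lift_definition scaleC_ell2 :: "complex \<Rightarrow> 'a ell2 \<Rightarrow> 'a ell2" is "\<lambda>a x i. a * x i"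
  by (rule sq_summable_scale)
lift_definition cinner_ell2 :: "'a ell2 \<Rightarrow> 'a ell2 \<Rightarrow> complex" is
  "\<lambda>x y. \<Sum>\<^sub>\<infinity>i. x i * cnj (y i)" .

instance
proof
  fix x y z :: "'a ell2" and a b :: complex and r :: real
  show "a *\<^sub>C (x + y) = a *\<^sub>C x + a *\<^sub>C y" "(a + b) *\<^sub>C x = a *\<^sub>C x + b *\<^sub>C x"
    "a *\<^sub>C b *\<^sub>C x = (a * b) *\<^sub>C x" "r *\<^sub>R x = complex_of_real r *\<^sub>C x"
    by (transfer; simp add: algebra_simps)+
  have summ: "(\<lambda>i. x i * cnj (y i)) summable_on UNIV" if "sq_summable x" "sq_summable y" for x y :: "'a \<Rightarrow> complex"
    using that by (intro sq_summable_prod) (auto simp: sq_summable_def)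
  show "cinner (x + y) z = cinner x z + cinner y z"
    by transfer (simp add: ring_distribs infsum_add summ)
  show "cinner (a *\<^sub>C x) y = a * cinner x y"
    by transfer (simp add: mult.assoc infsum_cmult_right')
  show "cinner x y = cnj (cinner y x)"
    by transfer (simp add: mult.commute flip: infsum_cnj)
  show "cinner x x = complex_of_real ((norm x)\<^sup>2)"
  proof transfer
    fix x :: "'a \<Rightarrow> complex"
    assume "sq_summable x"
    then have "((\<lambda>i. (cmod (x i))\<^sup>2) has_sum (l2_norm x)\<^sup>2) UNIV"
      unfolding l2_norm_sq sq_summable_def by (rule has_sum_infsum)
    then have "((\<lambda>i. complex_of_real ((cmod (x i))\<^sup>2)) has_sum complex_of_real ((l2_norm x)\<^sup>2)) UNIV"
      by (rule has_sum_bounded_linear[OF bounded_linear_of_real])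
    then show "(\<Sum>\<^sub>\<infinity>i. x i * cnj (x i)) = complex_of_real ((l2_norm x)\<^sup>2)"
      unfolding complex_norm_square by (rule infsumI)
  qed
qed

end

instance ell2 :: (type) chilbert_space
proof
  fix X :: "nat \<Rightarrow> 'a ell2"
  assume "Cauchy X"
  define x where "x n = Rep_ell2 (X n)" for n
  have x: "sq_summable (x n)" for n
    by (simp add: x_def sq_summable_Rep)
  have C: "\<exists>N. \<forall>m\<ge>N. \<forall>n\<ge>N. l2_norm (\<lambda>i. x m i - x n i) < e" if "e > 0" for e
    using \<open>Cauchy X\<close> that unfolding Cauchy_def dist_norm
    by (simp add: norm_ell2.rep_eq minus_ell2.rep_eq x_def)
  have coord: "cmod (x m i - x n i) \<le> l2_norm (\<lambda>i. x m i - x n i)" for m n i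
    using L2_set_le_l2_norm[OF sq_summable_diff[OF x x], of "{i}" m n] by simp
  have "Cauchy (\<lambda>n. x n i)" for i
    unfolding Cauchy_def dist_norm
  proof (intro allI impI)
    fix e :: real assume "e > 0"
    then obtain N where "\<forall>m\<ge>N. \<forall>n\<ge>N. l2_norm (\<lambda>i. x m i - x n i) < e"
      using C by blast
    then show "\<exists>N. \<forall>m\<ge>N. \<forall>n\<ge>N. cmod (x m i - x n i) < e"
      using le_less_trans[OF coord] by blast
  qed
  then have "\<forall>i. \<exists>l. (\<lambda>n. x n i) \<longlonglongrightarrow> l"
    by (simp add: Cauchy_convergent_iff convergent_def)
  then obtain l where l: "\<And>i. (\<lambda>n. x n i) \<longlonglongrightarrow> l i"
    by metis
  have lim: "\<exists>N. \<forall>m\<ge>N. sq_summable (\<lambda>i. x m i - l i) \<and> l2_norm (\<lambda>i. x m i - l i) \<le> e" if "e > 0" for e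
  proof -
    obtain N where N: "\<And>m n. m \<ge> N \<Longrightarrow> n \<ge> N \<Longrightarrow> l2_norm (\<lambda>i. x m i - x n i) < e"
      using C \<open>e > 0\<close> by blast
    have *: "L2_set (\<lambda>i. cmod (x m i - l i)) F \<le> e" if "m \<ge> N" "finite F" for m F
    proof (rule tendsto_upperbound)
      show "(\<lambda>n. L2_set (\<lambda>i. cmod (x m i - x n i)) F) \<longlonglongrightarrow> L2_set (\<lambda>i. cmod (x m i - l i)) F"
        unfolding L2_set_def by (intro tendsto_intros l)
      show "\<forall>\<^sub>F n in sequentially. L2_set (\<lambda>i. cmod (x m i - x n i)) F \<le> e"
        using eventually_ge_at_top[of N]
      proof eventually_elim
        case (elim n)
        show ?case
          using L2_set_le_l2_norm[OF sq_summable_diff[OF x x] that(2), of m n] N[OF that(1) elim]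
          by simp
      qed
    qed simp
    show ?thesis
      using sq_summable_bounded[OF *] by blast
  qed
  have "sq_summable l"
  proof -
    obtain m where "sq_summable (\<lambda>i. x m i - l i)"
      using lim[of 1] by auto
    from sq_summable_diff[OF x[of m] this] show ?thesis by simp
  qed
  then have *: "norm (X m - Abs_ell2 l) = l2_norm (\<lambda>i. x m i - l i)" for m
    by (simp add: norm_ell2.rep_eq minus_ell2.rep_eq x_def Abs_ell2_inverse)
  have "X \<longlonglongrightarrow> Abs_ell2 l"
    unfolding LIMSEQ_iff *
  proof (intro allI impI)
    fix e :: real assume "e > 0"
    then obtain N where "\<forall>m\<ge>N. l2_norm (\<lambda>i. x m i - l i) \<le> e / 2"
      using lim[of "e / 2"] by auto
    moreover have "e / 2 < e"
      using \<open>e > 0\<close> by simp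
    ultimately show "\<exists>N. \<forall>m\<ge>N. l2_norm (\<lambda>i. x m i - l i) < e"
      using le_less_trans by blast
  qed
  then show "convergent X"
    by (auto simp: convergent_def)
qed

definition bessel_bound :: "('i \<Rightarrow> 'a::complex_inner) \<Rightarrow> real \<Rightarrow> bool" where
  "bessel_bound \<Phi> B \<longleftrightarrow> B > 0 \<and>
     (\<forall>f. (\<lambda>i. (cmod (cinner f (\<Phi> i)))\<^sup>2) summable_on UNIV \<and>
          (\<Sum>\<^sub>\<infinity>i. (cmod (cinner f (\<Phi> i)))\<^sup>2) \<le> B * (norm f)\<^sup>2)"

definition bessel_seq :: "('i \<Rightarrow> 'a::complex_inner) \<Rightarrow> bool" where
  "bessel_seq \<Phi> \<longleftrightarrow> (\<exists>B. bessel_bound \<Phi> B)"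

definition synthesis :: "('i \<Rightarrow> 'a::complex_inner) \<Rightarrow> 'i ell2 \<Rightarrow> 'a" where
  "synthesis \<Phi> c = (\<Sum>\<^sub>\<infinity>i. Rep_ell2 c i *\<^sub>C \<Phi> i)"

definition cross_gram :: "('a::complex_inner \<Rightarrow> 'a) \<Rightarrow> ('i \<Rightarrow> 'a) \<Rightarrow> ('i \<Rightarrow> 'a) \<Rightarrow> 'i \<Rightarrow> 'i \<Rightarrow> complex" where
  "cross_gram U \<Phi> \<Psi> i j = cinner (U (\<Psi> j)) (\<Phi> i)"

(* Meaningful only if the rows converge against every c and the result is again in l^2;
   for Bessel sequences this holds (analysis_rep, cross_gram_row_has_sum), and the operator given
   by the cross Gram matrix is then the synthesis operator of Psi, followed by U, followed by the
   adjoint of the synthesis operator of Phi (cross_gram_op_synthesis, cinner_synthesis_analysis). *)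
definition matrix_op :: "('i \<Rightarrow> 'i \<Rightarrow> complex) \<Rightarrow> 'i ell2 \<Rightarrow> 'i ell2" where
  "matrix_op M c = Abs_ell2 (\<lambda>i. \<Sum>\<^sub>\<infinity>j. M i j * Rep_ell2 c j)"

abbreviation cross_gram_op :: "('a::complex_inner \<Rightarrow> 'a) \<Rightarrow> ('i \<Rightarrow> 'a) \<Rightarrow> ('i \<Rightarrow> 'a) \<Rightarrow> 'i ell2 \<Rightarrow> 'i ell2" where
  "cross_gram_op U \<Phi> \<Psi> \<equiv> matrix_op (cross_gram U \<Phi> \<Psi>)"

lemma cinner_zero_left [simp]: "cinner 0 (z::'a::complex_inner) = 0"
  using cinner_add_left[of 0 0 z] by simp

lemma cinner_sum_left: "cinner (\<Sum>i\<in>F. f i) (z::'a::complex_inner) = (\<Sum>i\<in>F. cinner (f i) z)"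
  by (induction F rule: infinite_finite_induct) (auto simp: cinner_add_left)

lemma cinner_add_right: "cinner x (y + z) = cinner x y + cinner (x::'a::complex_inner) z"
  by (metis cinner_add_left cinner_commute complex_cnj_add)

lemma cinner_scaleC_right: "cinner x (a *\<^sub>C y) = cnj a * cinner (x::'a::complex_inner) y"
  by (metis cinner_scaleC_left cinner_commute complex_cnj_mult)

lemma cinner_Cauchy_Schwarz: "cmod (cinner x y) \<le> norm x * norm (y::'a::complex_inner)"
proof (cases "y = 0")
  case True
  then show ?thesis
    by (metis cinner_commute cinner_zero_left complex_cnj_zero mult_zero_right norm_zero order_refl)
next
  case False
  define b where "b = cinner x y"
  define n where "n = (norm y)\<^sup>2"
  have n: "n > 0" using False by (simp add: n_def)
  define z where "z = complex_of_real n *\<^sub>C x + (- b) *\<^sub>C y"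
  have yx: "cinner y x = cnj b"
    by (simp add: b_def flip: cinner_commute)
  have "complex_of_real ((norm z)\<^sup>2) = cinner z z"
    by (simp add: cinner_self)
  also have "\<dots> = complex_of_real n * (complex_of_real (n * (norm x)\<^sup>2) - b * cnj b)"
    unfolding z_def cinner_add_left cinner_add_right cinner_scaleC_left cinner_scaleC_right
    unfolding cinner_self yx b_def[symmetric] n_def[symmetric]
    by (simp add: algebra_simps del: of_real_power)
  also have "\<dots> = complex_of_real (n * (n * (norm x)\<^sup>2 - (cmod b)\<^sup>2))"
    by (simp add: right_diff_distrib flip: complex_norm_square)
  finally have "(norm z)\<^sup>2 = n * (n * (norm x)\<^sup>2 - (cmod b)\<^sup>2)"
    by (simp only: of_real_eq_iff)
  then have "0 \<le> n * (n * (norm x)\<^sup>2 - (cmod b)\<^sup>2)"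
    by (metis zero_le_power2)
  then have "(cmod b)\<^sup>2 \<le> (norm x * norm y)\<^sup>2"
    using n by (simp add: zero_le_mult_iff power_mult_distrib mult.commute flip: n_def)
  then show ?thesis
    unfolding b_def by (rule power2_le_imp_le) simp
qed

lemma bounded_linear_cinner_left: "bounded_linear (\<lambda>x. cinner x (y::'a::complex_inner))"
proof (rule bounded_linear_intro)
  show "cinner (r *\<^sub>R x) y = r *\<^sub>R cinner x y" for r x
    by (simp add: scaleR_scaleC cinner_scaleC_left scaleR_conv_of_real)
qed (auto simp: cinner_add_left intro: cinner_Cauchy_Schwarz)

lemma norm_synthesis_finite_le:
  assumes "bessel_bound \<Psi> B" "finite F"
  shows "norm (\<Sum>i\<in>F. c i *\<^sub>C \<Psi> i) \<le> sqrt B * L2_set (\<lambda>i. cmod (c i)) F"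
proof -
  define f where "f = (\<Sum>i\<in>F. c i *\<^sub>C \<Psi> i)"
  have B: "B > 0" using assms by (simp add: bessel_bound_def)
  have "(\<Sum>i\<in>F. (cmod (cinner f (\<Psi> i)))\<^sup>2) \<le> (\<Sum>\<^sub>\<infinity>i. (cmod (cinner f (\<Psi> i)))\<^sup>2)"
    using assms by (intro finite_sum_le_infsum) (auto simp: bessel_bound_def)
  also have "\<dots> \<le> B * (norm f)\<^sup>2"
    using assms by (auto simp: bessel_bound_def)
  finally have *: "L2_set (\<lambda>i. cmod (cinner f (\<Psi> i))) F \<le> sqrt B * norm f"
    unfolding L2_set_def by (metis norm_ge_zero real_sqrt_le_mono real_sqrt_mult real_sqrt_unique)
  have "(norm f)\<^sup>2 = cmod (cinner f f)"
    by (simp add: cinner_self norm_power)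
  also have "cinner f f = (\<Sum>i\<in>F. c i * cinner (\<Psi> i) f)"
    by (subst (1) f_def) (simp add: cinner_sum_left cinner_scaleC_left)
  also have "cmod \<dots> \<le> (\<Sum>i\<in>F. cmod (c i) * cmod (cinner f (\<Psi> i)))"
    by (rule sum_norm_le) (metis cinner_commute complex_mod_cnj norm_mult order_refl)
  also have "\<dots> \<le> L2_set (\<lambda>i. cmod (c i)) F * L2_set (\<lambda>i. cmod (cinner f (\<Psi> i))) F"
    using L2_set_mult_ineq[of "\<lambda>i. cmod (c i)" "\<lambda>i. cmod (cinner f (\<Psi> i))" F] by simp
  also have "\<dots> \<le> L2_set (\<lambda>i. cmod (c i)) F * (sqrt B * norm f)"
    by (intro mult_left_mono *) simp
  finally have "norm f * norm f \<le> (sqrt B * L2_set (\<lambda>i. cmod (c i)) F) * norm f"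
    by (simp add: power2_eq_square mult_ac)
  then have "norm f \<le> sqrt B * L2_set (\<lambda>i. cmod (c i)) F"
    using B by (cases "norm f = 0") (auto simp: mult_le_cancel_right)
  then show ?thesis by (simp add: f_def)
qed

lemma synthesis_summable:
  fixes \<Psi> :: "'i \<Rightarrow> 'a::chilbert_space"
  assumes "bessel_bound \<Psi> B" "sq_summable c"
  shows "(\<lambda>i. c i *\<^sub>C \<Psi> i) summable_on UNIV"
proof -
  let ?f = "\<lambda>i. c i *\<^sub>C \<Psi> i" and ?g = "\<lambda>i. (cmod (c i))\<^sup>2"
  have B: "B > 0" using assms by (simp add: bessel_bound_def)
  have "\<exists>P. eventually P (finite_subsets_at_top UNIV) \<and>
            (\<forall>F F'. P F \<and> P F' \<longrightarrow> dist (sum ?f F) (sum ?f F') < e)" if "e > 0" for e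
  proof -
    define d where "d = (e / 2)\<^sup>2 / B"
    have d: "d > 0" using that B by (simp add: d_def)
    obtain S where "(?g has_sum S) UNIV"
      using assms(2) by (auto simp: sq_summable_def summable_on_def)
    then have "\<forall>\<^sub>F F in finite_subsets_at_top UNIV. dist (sum ?g F) S < d / 2"
      unfolding has_sum_def using d by (intro tendstoD) auto
    then obtain K where K: "finite K" "\<And>F. finite F \<Longrightarrow> K \<subseteq> F \<Longrightarrow> dist (sum ?g F) S < d / 2"
      by (auto simp: eventually_finite_subsets_at_top)
    have near: "dist (sum ?f F) (sum ?f K) < e / 2" if F: "finite F" "K \<subseteq> F" for F
    proof -
      have "dist (sum ?g F) (sum ?g K) < d"
        using K(2)[OF F] K(2)[OF K(1) order_refl] dist_triangle_half_r[of S "sum ?g F" d "sum ?g K"]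
        by (simp add: dist_commute)
      then have "sum ?g (F - K) < d"
        using F K(1) by (simp add: sum_diff dist_real_def)
      then have "B * sum ?g (F - K) < (e / 2)\<^sup>2"
        using B by (simp add: d_def field_simps)
      then have "sqrt B * L2_set (\<lambda>i. cmod (c i)) (F - K) < e / 2"
        unfolding L2_set_def real_sqrt_mult[symmetric] using \<open>e > 0\<close>
        by (intro real_less_lsqrt) auto
      moreover have "dist (sum ?f F) (sum ?f K) = norm (sum ?f (F - K))"
        using F K(1) by (simp add: sum_diff dist_norm)
      ultimately show ?thesis
        using norm_synthesis_finite_le[OF assms(1), of "F - K" c] F by simp
    qed
    show ?thesis
    proof (intro exI[of _ "\<lambda>F. finite F \<and> K \<subseteq> F"] conjI allI impI)
      show "\<forall>\<^sub>F F in finite_subsets_at_top UNIV. finite F \<and> K \<subseteq> F"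
        using K(1) by (auto simp: eventually_finite_subsets_at_top)
      show "dist (sum ?f F) (sum ?f F') < e" if "(finite F \<and> K \<subseteq> F) \<and> finite F' \<and> K \<subseteq> F'" for F F'
        using that near[of F] near[of F'] dist_triangle_half_l[of "sum ?f F" "sum ?f K" e "sum ?f F'"]
        by blast
    qed
  qed
  then have "cauchy_filter (filtermap (sum ?f) (finite_subsets_at_top UNIV))"
    by (simp add: cauchy_filter_metric_filtermap)
  moreover have "complete (UNIV :: 'a set)"
    by (meson Cauchy_convergent UNIV_I complete_def convergent_def)
  ultimately obtain L where "(sum ?f \<longlongrightarrow> L) (finite_subsets_at_top UNIV)"
    using complete_uniform[where S = "UNIV :: 'a set"] by (force simp add: filterlim_def)
  then show ?thesis
    using summable_on_def has_sum_def by blast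
qed

definition analysis :: "('i \<Rightarrow> 'a::complex_inner) \<Rightarrow> 'a \<Rightarrow> 'i ell2" where
  "analysis \<Phi> f = Abs_ell2 (\<lambda>i. cinner f (\<Phi> i))"

lemma analysis_rep:
  assumes "bessel_bound \<Phi> B"
  shows "Rep_ell2 (analysis \<Phi> f) = (\<lambda>i. cinner f (\<Phi> i))"
  using assms by (auto simp: analysis_def Abs_ell2_inverse sq_summable_def bessel_bound_def)

lemma cross_gram_row_has_sum:
  fixes \<Phi> \<Psi> :: "'i \<Rightarrow> 'a::chilbert_space"
  assumes "bounded_clinear U" "bessel_bound \<Psi> B"
  shows "((\<lambda>j. cross_gram U \<Phi> \<Psi> i j * Rep_ell2 c j) has_sum cinner (U (synthesis \<Psi> c)) (\<Phi> i)) UNIV"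
proof -
  have "bounded_linear U" and UC: "\<And>a x. U (a *\<^sub>C x) = a *\<^sub>C U x"
    using assms(1) by (auto simp: bounded_clinear_def)
  then have "bounded_linear (\<lambda>x. cinner (U x) (\<Phi> i))"
    using bounded_linear_compose[OF bounded_linear_cinner_left] by blast
  moreover have "((\<lambda>j. Rep_ell2 c j *\<^sub>C \<Psi> j) has_sum synthesis \<Psi> c) UNIV"
    unfolding synthesis_def
    by (intro has_sum_infsum synthesis_summable[OF assms(2)] sq_summable_Rep)
  ultimately have "((\<lambda>j. cinner (U (Rep_ell2 c j *\<^sub>C \<Psi> j)) (\<Phi> i)) has_sum cinner (U (synthesis \<Psi> c)) (\<Phi> i)) UNIV"
    by (rule has_sum_bounded_linear)
  then show ?thesis
    by (simp add: UC cinner_scaleC_left cross_gram_def mult.commute)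
qed

lemma cross_gram_op_synthesis:
  fixes \<Phi> \<Psi> :: "'i \<Rightarrow> 'a::chilbert_space"
  assumes "bounded_clinear U" "bessel_bound \<Psi> B"
  shows "cross_gram_op U \<Phi> \<Psi> c = analysis \<Phi> (U (synthesis \<Psi> c))"
  unfolding matrix_op_def analysis_def
  by (simp add: infsumI[OF cross_gram_row_has_sum[OF assms]])

lemma cinner_synthesis_analysis:
  fixes \<Phi> :: "'i \<Rightarrow> 'a::chilbert_space"
  assumes "bessel_bound \<Phi> B"
  shows "cinner (synthesis \<Phi> c) f = cinner c (analysis \<Phi> f)"
proof -
  have "((\<lambda>j. cross_gram (\<lambda>x. x) (\<lambda>_. f) \<Phi> i j * Rep_ell2 c j) has_sum cinner (synthesis \<Phi> c) f) UNIV" for i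
    using cross_gram_row_has_sum[of "\<lambda>x. x" \<Phi> B "\<lambda>_. f"] assms by (simp add: bounded_clinear_def)
  then have "((\<lambda>j. cinner (\<Phi> j) f * Rep_ell2 c j) has_sum cinner (synthesis \<Phi> c) f) UNIV"
    by (simp add: cross_gram_def)
  moreover have "cinner (\<Phi> j) f * Rep_ell2 c j = Rep_ell2 c j * cnj (Rep_ell2 (analysis \<Phi> f) j)" for j
    by (simp add: analysis_rep[OF assms] mult.commute flip: cinner_commute)
  ultimately show ?thesis
    by (simp add: cinner_ell2.rep_eq infsumI)
qed

end

theory Submission
  imports Defs
begin

text \<open>
  Each of the three changes alters the cross Gram matrix by another cross Gram matrix: replacing
  \<open>U\<close> by \<open>V\<close> subtracts the matrix of \<open>U - V\<close>, and replacing one of the sequences subtracts the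
  matrix in which that sequence is the difference of the old and the new one
  (\<open>matrix_op_cross_gram_diff\<close>). Since \<open>G = T\<^sub>\<Phi>\<^sup>* U T\<^sub>\<Psi>\<close>, and the synthesis operator and its adjoint
  are bounded by the square root of a Bessel bound, the operator of such a difference has norm at
  most \<open>\<surd>A \<cdot> \<parallel>W\<parallel> \<cdot> \<surd>B\<close> (\<open>norm_cross_gram_op_le\<close>). A sequence of differences
  that is square summable in norm is itself Bessel, with the sum of the squared norms as a bound
  (\<open>bessel_bound_of_sq_norm_sum\<close>). The three smallness hypotheses therefore all say that the
  perturbation \<open>D\<close> of the invertible operator \<open>G\<close> satisfies \<open>\<parallel>D\<parallel> \<cdot> \<parallel>G\<^sup>-\<^sup>1\<parallel> < 1\<close>, and the set of
  invertible operators contains the ball of radius \<open>1 / \<parallel>G\<^sup>-\<^sup>1\<parallel>\<close> around \<open>G\<close>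
  (\<open>bounded_invertible_perturb\<close>).
\<close>

section \<open>Stability of bounded invertibility\<close>

lemma cinner_diff_left: "cinner (x - y) (z::'a::complex_inner) = cinner x z - cinner y z"
  using cinner_add_left[of "x - y" y z] by simp

lemma cinner_diff_right: "cinner x (y - z) = cinner x y - cinner (x::'a::complex_inner) z"
  using cinner_add_right[of x "y - z" z] by simp

lemma scaleC_diff_right: "a *\<^sub>C (x - y) = a *\<^sub>C x - a *\<^sub>C (y::'a::complex_inner)"
  using scaleC_add_right[of a "x - y" y] by simp

lemma bounded_clinear_diff:
  assumes "bounded_clinear T" "bounded_clinear S"
  shows "bounded_clinear (\<lambda>x. T x - S x)"
  using assms by (auto simp: bounded_clinear_def scaleC_diff_right intro: bounded_linear_sub)

text \<open>
  The equation \<open>T' x = y\<close> holds iff \<open>x\<close> is a fixed point of \<open>x \<mapsto> x - S (T' x) + S y\<close> for the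
  inverse \<open>S\<close> of \<open>T\<close>. As \<open>x - S (T' x) = S (T x - T' x)\<close>, this map is a contraction, and the
  Banach fixed point theorem makes \<open>T'\<close> bijective. The bound of the inverse comes from the same
  contraction constant.
\<close>

lemma bounded_invertible_perturb:
  fixes T T' :: "'a::chilbert_space \<Rightarrow> 'b::complex_inner"
  assumes T: "bounded_invertible T" and T': "bounded_clinear T'"
    and d: "\<And>x. norm (T x - T' x) \<le> d * norm x" and small: "d * onorm (inv T) < 1"
  shows "bounded_invertible T'"
proof -
  obtain S where S: "bounded_clinear S" and ST: "S \<circ> T = id" and TS: "T \<circ> S = id"
    using T by (auto simp: bounded_invertible_def)
  have S_eq: "inv T = S"
    using inv_unique_comp[OF TS ST] .
  have blS: "bounded_linear S" and blT': "bounded_linear T'"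
    and T'C: "\<And>a x. T' (a *\<^sub>C x) = a *\<^sub>C T' x"
    using S T' by (auto simp: bounded_clinear_def)
  interpret S: bounded_linear S by (rule blS)
  interpret T': bounded_linear T' by (rule blT')
  have ST_id: "S (T x) = x" and TS_id: "T (S y) = y" for x y
    using ST TS by (auto simp: fun_eq_iff)
  \<comment> \<open>The given \<open>d\<close> may be negative if the space is trivial; the fixed point theorem needs a
    nonnegative constant.\<close>
  define q where "q = max 0 (d * onorm S)"
  have q: "0 \<le> q" "q < 1"
    using small by (auto simp: q_def S_eq)
  have contr: "norm (x - S (T' x)) \<le> q * norm x" for x
  proof -
    have "norm (x - S (T' x)) = norm (S (T x - T' x))"
      by (simp add: S.diff ST_id)
    also have "\<dots> \<le> onorm S * norm (T x - T' x)"
      by (rule onorm[OF blS])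
    also have "\<dots> \<le> onorm S * (d * norm x)"
      by (intro mult_left_mono d onorm_pos_le blS)
    also have "\<dots> \<le> q * norm x"
      unfolding q_def by (simp add: mult.assoc[symmetric] mult.commute[of "onorm S"] mult_right_mono)
    finally show ?thesis .
  qed
  have "\<exists>!x. T' x = y" for y
  proof -
    have "\<exists>!x. x - S (T' x) + S y = x"
    proof (rule banach_fix_type[OF q], intro allI)
      fix u v
      have "u - S (T' u) + S y - (v - S (T' v) + S y) = (u - v) - S (T' (u - v))"
        by (simp add: T'.diff S.diff)
      then show "dist (u - S (T' u) + S y) (v - S (T' v) + S y) \<le> q * dist u v"
        using contr[of "u - v"] by (simp only: dist_norm)
    qed
    moreover have "x - S (T' x) + S y = x \<longleftrightarrow> T' x = y" for x
    proof -
      have "x - S (T' x) + S y = x \<longleftrightarrow> S y = S (T' x)"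
        by (auto simp: algebra_simps)
      then show ?thesis
        by (metis TS_id)
    qed
    ultimately show ?thesis
      by simp
  qed
  then have "bij T'"
    by (auto simp: bij_iff)
  then have inj: "inv T' (T' x) = x" and surj: "T' (inv T' y) = y" for x y
    by (auto simp: bij_is_inj bij_is_surj surj_f_inv_f)
  have bound: "norm (inv T' y) \<le> norm y * (onorm S / (1 - q))" for y
  proof -
    have "norm (inv T' y) - norm (S y) \<le> q * norm (inv T' y)"
      using contr[of "inv T' y"] norm_triangle_ineq2[of "inv T' y" "S y"] by (simp add: surj)
    then have "norm (inv T' y) * (1 - q) \<le> onorm S * norm y"
      using onorm[OF blS, of y] by (simp add: algebra_simps)
    then show ?thesis
      using q by (simp add: field_simps)
  qed
  have "bounded_linear (inv T')"
  proof (rule bounded_linear_intro)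
    show "inv T' (x + y) = inv T' x + inv T' y" for x y
      by (metis T'.add inj surj)
    show "inv T' (r *\<^sub>R x) = r *\<^sub>R inv T' x" for r x
      by (metis T'.scaleR inj surj)
  qed (rule bound)
  moreover have "inv T' (a *\<^sub>C x) = a *\<^sub>C inv T' x" for a x
    by (metis T'C inj surj)
  ultimately have "bounded_clinear (inv T')"
    by (simp add: bounded_clinear_def)
  moreover have "inv T' \<circ> T' = id" "T' \<circ> inv T' = id"
    by (auto simp: inj surj)
  ultimately show ?thesis
    using T' by (auto simp: bounded_invertible_def)
qed

section \<open>Cross Gram operators: norm bound and linearity\<close>

lemma norm_analysis_le:
  assumes "bessel_bound \<Phi> B"
  shows "norm (analysis \<Phi> f) \<le> sqrt B * norm f"
proof -
  have "norm (analysis \<Phi> f) = sqrt (\<Sum>\<^sub>\<infinity>i. (cmod (cinner f (\<Phi> i)))\<^sup>2)"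
    by (simp add: norm_ell2.rep_eq analysis_rep[OF assms] l2_norm_def)
  also have "\<dots> \<le> sqrt (B * (norm f)\<^sup>2)"
    using assms by (simp add: bessel_bound_def)
  finally show ?thesis
    by (simp add: real_sqrt_mult)
qed

text \<open>
  The synthesis operator inherits the bound of its adjoint:
  \<open>\<parallel>T c\<parallel>\<^sup>2 = \<langle>c, T\<^sup>* T c\<rangle> \<le> \<parallel>c\<parallel> \<cdot> \<surd>B \<cdot> \<parallel>T c\<parallel>\<close>.
\<close>

lemma norm_synthesis_le:
  fixes \<Psi> :: "'i \<Rightarrow> 'a::chilbert_space"
  assumes "bessel_bound \<Psi> B"
  shows "norm (synthesis \<Psi> c) \<le> sqrt B * norm c"
proof -
  let ?s = "synthesis \<Psi> c"
  have "norm ?s * norm ?s = cmod (cinner ?s ?s)"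
    by (simp add: cinner_self norm_power power2_eq_square norm_mult)
  also have "\<dots> = cmod (cinner c (analysis \<Psi> ?s))"
    by (simp add: cinner_synthesis_analysis[OF assms])
  also have "\<dots> \<le> norm c * norm (analysis \<Psi> ?s)"
    by (rule cinner_Cauchy_Schwarz)
  also have "\<dots> \<le> norm c * (sqrt B * norm ?s)"
    by (intro mult_left_mono norm_analysis_le[OF assms]) simp
  finally have "norm ?s * norm ?s \<le> (sqrt B * norm c) * norm ?s"
    by (simp add: mult_ac)
  then show ?thesis
    using assms by (cases "norm ?s = 0") (auto simp: bessel_bound_def mult_le_cancel_right)
qed

lemma norm_cross_gram_op_le:
  fixes \<Phi> \<Psi> :: "'i \<Rightarrow> 'a::chilbert_space"
  assumes U: "bounded_clinear U" and \<Phi>: "bessel_bound \<Phi> A" and \<Psi>: "bessel_bound \<Psi> B"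
  shows "norm (cross_gram_op U \<Phi> \<Psi> c) \<le> sqrt A * onorm U * sqrt B * norm c"
proof -
  have blU: "bounded_linear U" and A: "0 \<le> sqrt A"
    using U \<Phi> by (auto simp: bounded_clinear_def bessel_bound_def)
  have "norm (cross_gram_op U \<Phi> \<Psi> c) \<le> sqrt A * norm (U (synthesis \<Psi> c))"
    unfolding cross_gram_op_synthesis[OF U \<Psi>] by (rule norm_analysis_le[OF \<Phi>])
  also have "\<dots> \<le> sqrt A * (onorm U * norm (synthesis \<Psi> c))"
    using A by (intro mult_left_mono onorm blU)
  also have "\<dots> \<le> sqrt A * (onorm U * (sqrt B * norm c))"
    using A by (intro mult_left_mono norm_synthesis_le[OF \<Psi>] onorm_pos_le blU)
  finally show ?thesis
    by (simp add: mult.assoc)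
qed

lemma cross_gram_op_has_sum:
  fixes \<Phi> \<Psi> :: "'i \<Rightarrow> 'a::chilbert_space"
  assumes U: "bounded_clinear U" and \<Phi>: "bessel_bound \<Phi> A" and \<Psi>: "bessel_bound \<Psi> B"
  shows "((\<lambda>j. cross_gram U \<Phi> \<Psi> i j * Rep_ell2 c j) has_sum
           Rep_ell2 (cross_gram_op U \<Phi> \<Psi> c) i) UNIV"
  using cross_gram_row_has_sum[OF U \<Psi>]
  by (simp add: cross_gram_op_synthesis[OF U \<Psi>] analysis_rep[OF \<Phi>])

lemma bounded_clinear_cross_gram_op:
  fixes \<Phi> \<Psi> :: "'i \<Rightarrow> 'a::chilbert_space"
  assumes U: "bounded_clinear U" and \<Phi>: "bessel_bound \<Phi> A" and \<Psi>: "bessel_bound \<Psi> B"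
  shows "bounded_clinear (cross_gram_op U \<Phi> \<Psi>)"
proof -
  let ?G = "cross_gram_op U \<Phi> \<Psi>"
  note hs = cross_gram_op_has_sum[OF U \<Phi> \<Psi>]
  have add: "?G (x + y) = ?G x + ?G y" for x y
  proof (rule Rep_ell2_inject[THEN iffD1], rule ext)
    fix i
    show "Rep_ell2 (?G (x + y)) i = Rep_ell2 (?G x + ?G y) i"
      using has_sum_unique[OF hs[of i "x + y"]] has_sum_add[OF hs[of i x] hs[of i y]]
      by (simp add: plus_ell2.rep_eq distrib_left)
  qed
  have scale: "?G (a *\<^sub>C x) = a *\<^sub>C ?G x" for a x
  proof (rule Rep_ell2_inject[THEN iffD1], rule ext)
    fix i
    show "Rep_ell2 (?G (a *\<^sub>C x)) i = Rep_ell2 (a *\<^sub>C ?G x) i"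
      using has_sum_unique[OF hs[of i "a *\<^sub>C x"]] has_sum_cmult_right[OF hs[of i x], of a]
      by (simp add: scaleC_ell2.rep_eq mult_ac)
  qed
  have "bounded_linear ?G"
  proof (rule bounded_linear_intro[of _ "sqrt A * onorm U * sqrt B"])
    show "norm (?G x) \<le> norm x * (sqrt A * onorm U * sqrt B)" for x
      using norm_cross_gram_op_le[OF U \<Phi> \<Psi>] by (simp add: mult.commute)
  qed (simp_all add: add scale scaleR_scaleC)
  then show ?thesis
    by (simp add: bounded_clinear_def scale)
qed

text \<open>
  The hypothesis compares matrix entries, so that one statement serves for a change of the operator
  and of either sequence.
\<close>

lemma matrix_op_cross_gram_diff:
  fixes \<Phi> \<Psi> \<Phi>' \<Psi>' \<Phi>'' \<Psi>'' :: "'i \<Rightarrow> 'a::chilbert_space"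
  assumes G: "bounded_clinear U" "bessel_bound \<Phi> A" "bessel_bound \<Psi> B"
    and G': "bounded_clinear U'" "bessel_bound \<Phi>' A'" "bessel_bound \<Psi>' B'"
    and G'': "bounded_clinear U''" "bessel_bound \<Phi>'' A''" "bessel_bound \<Psi>'' B''"
    and entries: "\<And>i j. cross_gram U \<Phi> \<Psi> i j - cross_gram U' \<Phi>' \<Psi>' i j = cross_gram U'' \<Phi>'' \<Psi>'' i j"
  shows "cross_gram_op U \<Phi> \<Psi> c - cross_gram_op U' \<Phi>' \<Psi>' c = cross_gram_op U'' \<Phi>'' \<Psi>'' c"
proof (rule Rep_ell2_inject[THEN iffD1], rule ext)
  fix i
  have "((\<lambda>j. cross_gram U \<Phi> \<Psi> i j * Rep_ell2 c j) has_sum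
          Rep_ell2 (cross_gram_op U' \<Phi>' \<Psi>' c) i + Rep_ell2 (cross_gram_op U'' \<Phi>'' \<Psi>'' c) i) UNIV"
    using has_sum_add[OF cross_gram_op_has_sum[OF G'] cross_gram_op_has_sum[OF G''], of i c i c]
    by (simp add: left_diff_distrib flip: entries)
  from has_sum_unique[OF cross_gram_op_has_sum[OF G] this]
  show "Rep_ell2 (cross_gram_op U \<Phi> \<Psi> c - cross_gram_op U' \<Phi>' \<Psi>' c) i
      = Rep_ell2 (cross_gram_op U'' \<Phi>'' \<Psi>'' c) i"
    by (simp add: minus_ell2.rep_eq)
qed

lemma bounded_invertible_cross_gram_perturb:
  fixes \<Phi> \<Psi> \<Phi>' \<Psi>' \<Phi>'' \<Psi>'' :: "'i \<Rightarrow> 'a::chilbert_space"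
  assumes invertible: "bounded_invertible (cross_gram_op U \<Phi> \<Psi>)"
    and G: "bounded_clinear U" "bessel_bound \<Phi> A" "bessel_bound \<Psi> B"
    and G': "bounded_clinear U'" "bessel_bound \<Phi>' A'" "bessel_bound \<Psi>' B'"
    and G'': "bounded_clinear U''" "bessel_bound \<Phi>'' A''" "bessel_bound \<Psi>'' B''"
    and entries: "\<And>i j. cross_gram U \<Phi> \<Psi> i j - cross_gram U' \<Phi>' \<Psi>' i j = cross_gram U'' \<Phi>'' \<Psi>'' i j"
    and small: "sqrt A'' * onorm U'' * sqrt B'' * onorm (inv (cross_gram_op U \<Phi> \<Psi>)) < 1"
  shows "bounded_invertible (cross_gram_op U' \<Phi>' \<Psi>')"
proof (rule bounded_invertible_perturb[OF invertible bounded_clinear_cross_gram_op[OF G'] _ small])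
  show "norm (cross_gram_op U \<Phi> \<Psi> c - cross_gram_op U' \<Phi>' \<Psi>' c)
          \<le> sqrt A'' * onorm U'' * sqrt B'' * norm c" for c
    unfolding matrix_op_cross_gram_diff[OF G G' G'' entries] by (rule norm_cross_gram_op_le[OF G''])
qed

section \<open>Bessel bounds from square summable norms\<close>

text \<open>
  Cauchy-Schwarz in each term. A Bessel bound is positive by definition, so a positive majorant \<open>B\<close>
  of the sum stands in for the sum, which may vanish.
\<close>

lemma bessel_bound_of_sq_norm_sum:
  assumes summ: "(\<lambda>i. (norm (\<Delta> i))\<^sup>2) summable_on UNIV"
    and le: "(\<Sum>\<^sub>\<infinity>i. (norm (\<Delta> i))\<^sup>2) \<le> B" and B: "B > 0"
  shows "bessel_bound \<Delta> B"
  unfolding bessel_bound_def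
proof (intro conjI allI)
  fix f
  have term_le: "(cmod (cinner f (\<Delta> i)))\<^sup>2 \<le> (norm (\<Delta> i))\<^sup>2 * (norm f)\<^sup>2" for i
    using power_mono[OF cinner_Cauchy_Schwarz[of f "\<Delta> i"], of 2]
    by (simp add: power_mult_distrib mult.commute)
  have summ': "(\<lambda>i. (norm (\<Delta> i))\<^sup>2 * (norm f)\<^sup>2) summable_on UNIV"
    by (rule summable_on_cmult_left[OF summ])
  show summ_f: "(\<lambda>i. (cmod (cinner f (\<Delta> i)))\<^sup>2) summable_on UNIV"
    by (rule summable_on_comparison_test[OF summ' term_le]) simp
  have "(\<Sum>\<^sub>\<infinity>i. (cmod (cinner f (\<Delta> i)))\<^sup>2) \<le> (\<Sum>\<^sub>\<infinity>i. (norm (\<Delta> i))\<^sup>2 * (norm f)\<^sup>2)"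
    by (rule infsum_mono[OF summ_f summ' term_le])
  also have "\<dots> = (\<Sum>\<^sub>\<infinity>i. (norm (\<Delta> i))\<^sup>2) * (norm f)\<^sup>2"
    by (rule infsum_cmult_left')
  also have "\<dots> \<le> B * (norm f)\<^sup>2"
    by (intro mult_right_mono le) simp
  finally show "(\<Sum>\<^sub>\<infinity>i. (cmod (cinner f (\<Delta> i)))\<^sup>2) \<le> B * (norm f)\<^sup>2" .
qed (rule B)

text \<open>
  The strict inequality leaves room for a Bessel bound \<open>B\<close> whose square root lies strictly between
  the two sides; such a \<open>B\<close> is positive even if all differences vanish.
\<close>

lemma bessel_bound_of_sq_norm_sum_less:
  assumes summ: "(\<lambda>i. (norm (\<Delta> i))\<^sup>2) summable_on UNIV"
    and less: "sqrt (\<Sum>\<^sub>\<infinity>i. (norm (\<Delta> i))\<^sup>2) < r"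
  obtains B where "bessel_bound \<Delta> B" "sqrt B < r"
proof -
  obtain s where s: "sqrt (\<Sum>\<^sub>\<infinity>i. (norm (\<Delta> i))\<^sup>2) < s" "s < r"
    using dense[OF less] by blast
  have "0 \<le> sqrt (\<Sum>\<^sub>\<infinity>i. (norm (\<Delta> i))\<^sup>2)"
    by (simp add: infsum_nonneg)
  then have "s > 0"
    using s(1) by linarith
  moreover have "(\<Sum>\<^sub>\<infinity>i. (norm (\<Delta> i))\<^sup>2) \<le> s\<^sup>2"
    using s(1) by (intro sqrt_le_D) simp
  ultimately show ?thesis
    using that[of "s\<^sup>2"] bessel_bound_of_sq_norm_sum[OF summ, of "s\<^sup>2"] s(2) by simp
qed

section \<open>Perturbation of the operator and of the sequences\<close>

text \<open>
  The value \<open>r = 0\<close> is included because \<open>r\<close> will be a product of norms, one of which may vanish.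
\<close>

lemma mult_less_one_of_less_inverse:
  fixes s r :: real
  assumes "s < 1 / r" "0 \<le> r"
  shows "s * r < 1"
  using assms by (cases "r = 0") (auto simp: field_simps)

theorem theorem6p3:
  fixes U :: "'a::chilbert_space \<Rightarrow> 'a"
    and \<Phi> \<Psi> :: "'i::countable \<Rightarrow> 'a"
    and B\<^sub>\<Phi> B\<^sub>\<Psi> :: real
  assumes "separable_space (euclidean :: 'a topology)"
    and "bounded_clinear U"
    and "bessel_bound \<Phi> B\<^sub>\<Phi>"
    and "bessel_bound \<Psi> B\<^sub>\<Psi>"
    and "bounded_invertible (cross_gram_op U \<Phi> \<Psi>)"
  shows
    "(\<forall>V :: 'a \<Rightarrow> 'a. bounded_clinear V \<longrightarrow>
        onorm (\<lambda>f. U f - V f)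
          < 1 / (onorm (inv (cross_gram_op U \<Phi> \<Psi>)) * sqrt (B\<^sub>\<Phi> * B\<^sub>\<Psi>)) \<longrightarrow>
        bounded_invertible (cross_gram_op V \<Phi> \<Psi>)) \<and>
     (\<forall>\<Xi> :: 'i \<Rightarrow> 'a. bessel_seq \<Xi> \<longrightarrow>
        (\<lambda>i. (norm (\<Psi> i - \<Xi> i))\<^sup>2) summable_on UNIV \<longrightarrow>
        sqrt (\<Sum>\<^sub>\<infinity>i. (norm (\<Psi> i - \<Xi> i))\<^sup>2)
          < 1 / (onorm (inv (cross_gram_op U \<Phi> \<Psi>)) * sqrt B\<^sub>\<Phi> * onorm U) \<longrightarrow>
        bounded_invertible (cross_gram_op U \<Phi> \<Xi>)) \<and>
     (\<forall>\<Theta> :: 'i \<Rightarrow> 'a. bessel_seq \<Theta> \<longrightarrow>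
        (\<lambda>i. (norm (\<Phi> i - \<Theta> i))\<^sup>2) summable_on UNIV \<longrightarrow>
        sqrt (\<Sum>\<^sub>\<infinity>i. (norm (\<Phi> i - \<Theta> i))\<^sup>2)
          < 1 / (onorm (inv (cross_gram_op U \<Phi> \<Psi>)) * sqrt B\<^sub>\<Psi> * onorm U) \<longrightarrow>
        bounded_invertible (cross_gram_op U \<Theta> \<Psi>))"
proof (intro conjI allI impI)
  let ?n = "onorm (inv (cross_gram_op U \<Phi> \<Psi>))"
  note U = assms(2) and \<Phi> = assms(3) and \<Psi> = assms(4) and invertible = assms(5)
  have blU: "bounded_linear U" and pos: "0 \<le> B\<^sub>\<Phi>" "0 \<le> B\<^sub>\<Psi>"
    using U \<Phi> \<Psi> by (auto simp: bounded_clinear_def bessel_bound_def)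
  obtain S where "bounded_clinear S" "inv (cross_gram_op U \<Phi> \<Psi>) = S"
    using invertible unfolding bounded_invertible_def by (metis inv_unique_comp)
  then have n: "0 \<le> ?n"
    by (auto simp: bounded_clinear_def intro: onorm_pos_le)
  have nU: "0 \<le> onorm U"
    by (rule onorm_pos_le[OF blU])
  note linear_entry = linear_diff[OF bounded_linear.linear[OF blU]]
  show "bounded_invertible (cross_gram_op V \<Phi> \<Psi>)"
    if V: "bounded_clinear V"
      and less: "onorm (\<lambda>f. U f - V f) < 1 / (?n * sqrt (B\<^sub>\<Phi> * B\<^sub>\<Psi>))" for V
  proof (rule bounded_invertible_cross_gram_perturb
      [OF invertible U \<Phi> \<Psi> V \<Phi> \<Psi> bounded_clinear_diff[OF U V] \<Phi> \<Psi>])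
    show "sqrt B\<^sub>\<Phi> * onorm (\<lambda>f. U f - V f) * sqrt B\<^sub>\<Psi> * ?n < 1"
      using mult_less_one_of_less_inverse[OF less] n pos by (simp add: real_sqrt_mult mult_ac)
  qed (simp add: cross_gram_def cinner_diff_left)
  show "bounded_invertible (cross_gram_op U \<Phi> \<Xi>)"
    if bessel: "bessel_seq \<Xi>" and summ: "(\<lambda>i. (norm (\<Psi> i - \<Xi> i))\<^sup>2) summable_on UNIV"
      and less: "sqrt (\<Sum>\<^sub>\<infinity>i. (norm (\<Psi> i - \<Xi> i))\<^sup>2) < 1 / (?n * sqrt B\<^sub>\<Phi> * onorm U)"
    for \<Xi> :: "'i \<Rightarrow> 'a"
  proof -
    obtain B' where \<Xi>: "bessel_bound \<Xi> B'"
      using bessel by (auto simp: bessel_seq_def)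
    obtain B where B: "bessel_bound (\<lambda>i. \<Psi> i - \<Xi> i) B" "sqrt B < 1 / (?n * sqrt B\<^sub>\<Phi> * onorm U)"
      using bessel_bound_of_sq_norm_sum_less[OF summ less] .
    show ?thesis
    proof (rule bounded_invertible_cross_gram_perturb[OF invertible U \<Phi> \<Psi> U \<Phi> \<Xi> U \<Phi> B(1)])
      show "sqrt B\<^sub>\<Phi> * onorm U * sqrt B * ?n < 1"
        using mult_less_one_of_less_inverse[OF B(2)] n nU pos by (simp add: mult_ac)
    qed (simp add: cross_gram_def cinner_diff_left linear_entry)
  qed
  show "bounded_invertible (cross_gram_op U \<Theta> \<Psi>)"
    if bessel: "bessel_seq \<Theta>" and summ: "(\<lambda>i. (norm (\<Phi> i - \<Theta> i))\<^sup>2) summable_on UNIV"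
      and less: "sqrt (\<Sum>\<^sub>\<infinity>i. (norm (\<Phi> i - \<Theta> i))\<^sup>2) < 1 / (?n * sqrt B\<^sub>\<Psi> * onorm U)"
    for \<Theta> :: "'i \<Rightarrow> 'a"
  proof -
    obtain A' where \<Theta>: "bessel_bound \<Theta> A'"
      using bessel by (auto simp: bessel_seq_def)
    obtain A where A: "bessel_bound (\<lambda>i. \<Phi> i - \<Theta> i) A" "sqrt A < 1 / (?n * sqrt B\<^sub>\<Psi> * onorm U)"
      using bessel_bound_of_sq_norm_sum_less[OF summ less] .
    show ?thesis
    proof (rule bounded_invertible_cross_gram_perturb[OF invertible U \<Phi> \<Psi> U \<Theta> \<Psi> U A(1) \<Psi>])
      show "sqrt A * onorm U * sqrt B\<^sub>\<Psi> * ?n < 1"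
        using mult_less_one_of_less_inverse[OF A(2)] n nU pos by (simp add: mult_ac)
    qed (simp add: cross_gram_def cinner_diff_right)
  qed
qed

end
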